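(* Let $q$ be an odd power of $2$, let $\mathrm{Tr}:\mathbb{F}_q\to\mathbb{F}_2$ be the absolute trace, and let $\perp$ be the pseudo polarity of $\mathrm{PG}(2,q)$ mapping the point $P=(x_1,x_2,x_3)$ to the line $P^\perp: x_1X_1 + x_3X_2 + x_2X_3 = 0$. Then there exists a maximal arc $\mathcal{A}$ of Denniston type of degree $\sqrt{q/2}$ in $\mathrm{PG}(2,q)$ such that for every point $P \in \mathcal{A}$, the line $P^\perp$ contains no point of $\mathcal{A}$.
   Context: A maximal arc of degree $n$ in $\mathrm{PG}(2,q)$ is a set of $(n-1)q+n$ points such that every line meets it in $0$ or $n$ points. Maximal arcs of Denniston type are constructed as follows: fix $\alpha\in\mathbb{F}_q$ with $\mathrm{Tr}(\alpha)=1$ and, for $\mu\in\mathbb{F}_q$, let $\mathcal{C}_\mu$ be the set of points satisfying $X_2^2+X_2X_3+\alpha X_3^2+\mu X_1^2=0$; for an additive subgroup $A$ of $\mathbb{F}_q$ of order $n$, the union $\bigcup_{\mu\in A}\mathcal{C}_\mu$ is a maximal arc of degree $n$ (a Denniston maximal arc). *)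

theory Defs
  imports "HOL-Analysis.Analysis" "HOL-Library.Discrete_Functions"
begin

text \<open>
  Throughout, the finite field of order \<open>q\<close> is a type of class \<open>{field, finite}\<close> with
  \<open>q = CARD('a)\<close>, and \<open>PG(2,q)\<close> consists of the subspaces of dimension 1 (points) and 2 (lines) of
  \<open>'a ^ 3\<close>, incidence being inclusion.
\<close>

definition pg_points :: "('a::{field,finite} ^ 3) set set" where
  "pg_points = {P. vec.subspace P \<and> vec.dim P = 1}"

definition pg_lines :: "('a::{field,finite} ^ 3) set set" where
  "pg_lines = {L. vec.subspace L \<and> vec.dim L = 2}"

text \<open>
  The conjunct \<open>0 < n\<close> only rules out the artefact of truncated subtraction at \<open>n = 0\<close>.
\<close>

definition maximal_arc :: "nat \<Rightarrow> ('a::{field,finite} ^ 3) set set \<Rightarrow> bool" where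
  "maximal_arc n S \<longleftrightarrow>
     0 < n \<and> S \<subseteq> pg_points \<and> card S = (n - 1) * CARD('a) + n \<and>
     (\<forall>L\<in>pg_lines. card {P \<in> S. P \<subseteq> L} = 0 \<or> card {P \<in> S. P \<subseteq> L} = n)"

text \<open>
  The absolute trace for \<open>q = 2 ^ h\<close>, where \<open>floor_log q = h\<close>. Its values lie in the prime subfield
  \<open>{0, 1}\<close> of \<open>'a\<close>. Meaningful only when \<open>q\<close> is a power of 2.
\<close>

definition abs_trace :: "'a::{field,finite} \<Rightarrow> 'a" where
  "abs_trace x = (\<Sum>i<floor_log CARD('a). x ^ (2 ^ i))"

definition additive_subgroup :: "'a::ab_group_add set \<Rightarrow> bool" where
  "additive_subgroup A \<longleftrightarrow> 0 \<in> A \<and> (\<forall>x\<in>A. \<forall>y\<in>A. x + y \<in> A) \<and> (\<forall>x\<in>A. - x \<in> A)"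

text \<open>
  A homogeneous equation holds at a point if it holds at all (equivalently, by the lemma below, at
  one nonzero) of its coordinate vectors; the same applies to the polarity.
\<close>

definition denniston_conic :: "'a::{field,finite} \<Rightarrow> 'a \<Rightarrow> ('a ^ 3) set set" where
  "denniston_conic \<alpha> \<mu> =
     {P \<in> pg_points. \<forall>x\<in>P. (x $ 2)\<^sup>2 + x $ 2 * x $ 3 + \<alpha> * (x $ 3)\<^sup>2 + \<mu> * (x $ 1)\<^sup>2 = 0}"

definition denniston_maximal_arc :: "nat \<Rightarrow> ('a::{field,finite} ^ 3) set set \<Rightarrow> bool" where
  "denniston_maximal_arc n S \<longleftrightarrow>
     maximal_arc n S \<and>
     (\<exists>\<alpha> A. abs_trace \<alpha> = 1 \<and> additive_subgroup A \<and> card A = n \<and>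
            S = (\<Union>\<mu>\<in>A. denniston_conic \<alpha> \<mu>))"

definition pseudo_polarity :: "('a::{field,finite} ^ 3) set \<Rightarrow> ('a ^ 3) set" where
  "pseudo_polarity P = {X. \<forall>x\<in>P. x $ 1 * X $ 1 + x $ 3 * X $ 2 + x $ 2 * X $ 3 = 0}"

lemma span_in_pg_points:
  fixes v :: "'a::{field,finite} ^ 3"
  assumes "v \<noteq> 0"
  shows "vec.span {v} \<in> pg_points"
  using assms by (simp add: pg_points_def vec.dim_span vec.dim_eq_card_independent)

lemma span_in_denniston_conic_iff:
  fixes v :: "'a::{field,finite} ^ 3"
  assumes "v \<noteq> 0"
  shows "vec.span {v} \<in> denniston_conic \<alpha> \<mu> \<longleftrightarrow>
    (v $ 2)\<^sup>2 + v $ 2 * v $ 3 + \<alpha> * (v $ 3)\<^sup>2 + \<mu> * (v $ 1)\<^sup>2 = 0" (is "_ \<longleftrightarrow> ?f v = 0")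
proof -
  have "?f (k *s v) = k\<^sup>2 * ?f v" for k
    by (simp add: algebra_simps power2_eq_square)
  moreover have "v \<in> vec.span {v}"
    by (simp add: vec.span_base)
  ultimately show ?thesis
    using span_in_pg_points[OF assms] by (auto simp: denniston_conic_def vec.span_singleton)
qed

lemma pseudo_polarity_span:
  fixes v :: "'a::{field,finite} ^ 3"
  shows "pseudo_polarity (vec.span {v}) = {X. v $ 1 * X $ 1 + v $ 3 * X $ 2 + v $ 2 * X $ 3 = 0}"
    (is "_ = {X. ?b v X = 0}")
proof -
  have "?b (k *s v) X = k * ?b v X" for k X
    by (simp add: algebra_simps)
  moreover have "v \<in> vec.span {v}"
    by (simp add: vec.span_base)
  ultimately show ?thesis
    by (auto simp: pseudo_polarity_def vec.span_singleton)
qed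

end

theory Submission imports Defs begin

text \<open>
  Take \<open>\<alpha> = 1\<close>, which has trace 1 since \<open>q = 2 ^ h\<close> with \<open>h\<close> odd. The arc then consists of the
  points \<open>(1, a, b)\<close> with \<open>N(a, b) = a\<^sup>2 + a b + b\<^sup>2 \<in> A\<close>, where \<open>N\<close> is the norm form of
  \<open>GF(q\<^sup>2) / GF(q)\<close>. If \<open>(1, c, d)\<close> lies on the polar line of \<open>(1, a, b)\<close>, that is \<open>a d + b c = 1\<close>,
  then multiplicativity of the norm gives \<open>N(a, b) N(c, d) = e\<^sup>2 + e + 1\<close> for some \<open>e\<close>, an element
  of trace 1. So it suffices that \<open>A\<close> is totally isotropic for the form \<open>Tr(x y)\<close>. This form is
  alternating on the kernel of the trace (as \<open>Tr(x\<^sup>2) = Tr(x)\<close>) and nondegenerate there, hence a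
  totally isotropic subgroup of order \<open>2 ^ ((h - 1) / 2) = sqrt (q / 2)\<close> exists.

  That the union of conics is a maximal arc: restricted to an affine line, \<open>N\<close> is a quadratic
  polynomial in the parameter. On lines through the common nucleus \<open>(1, 0, 0)\<close> it is a bijection;
  on the others it is, up to scaling, \<open>s\<^sup>2 + s\<close> plus a constant of trace 1, hence two-to-one onto
  the elements of trace 1, which make up none or half of the scaled copy of \<open>A\<close>.
\<close>

section \<open>Frobenius and the characteristic of a finite field\<close>

lemma finite_field_power_card:
  fixes x :: "'a::{field,finite}"
  shows "x ^ CARD('a) = x"
proof (cases "x = 0")
  case False
  \<comment> \<open>Multiplication by \<open>x\<close> permutes the nonzero elements, so their
    product, itself nonzero, cancels.\<close>
  have "(\<Prod>y\<in>UNIV - {0}. x * y) = (\<Prod>y\<in>UNIV - {0::'a}. y)"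
    using False
    by (intro prod.reindex_bij_witness[where i = "\<lambda>y. y / x" and j = "\<lambda>y. x * y"]) auto
  then have "x ^ card (UNIV - {0::'a}) * (\<Prod>y\<in>UNIV - {0::'a}. y) = (\<Prod>y\<in>UNIV - {0::'a}. y)"
    by (simp add: prod.distrib)
  then have "x ^ card (UNIV - {0::'a}) = 1"
    by simp
  moreover have "CARD('a) = Suc (card (UNIV - {0::'a}))"
    by (metis UNIV_I card.remove finite)
  ultimately show ?thesis by (simp only: power_Suc mult_1_right)
qed (simp add: power_0_left)

text \<open>Translation by 1 permutes the ring, so summing all elements before and after it leaves a
  surplus of \<open>CARD('a)\<close> ones that must vanish.\<close>

lemma of_nat_card_eq_0:
  "of_nat CARD('a) = (0 :: 'a::{ring_1,finite})"
proof -
  have "(\<Sum>y\<in>UNIV. y + 1) = (\<Sum>y\<in>UNIV. y :: 'a)"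
    by (intro sum.reindex_bij_witness[where i = "\<lambda>y. y - 1" and j = "\<lambda>y. y + 1"]) auto
  then show ?thesis by (simp add: sum.distrib)
qed

section \<open>Arithmetic in characteristic 2\<close>

locale odd_binary_field =
  fixes h :: nat and field_type :: "'a::{field,finite} itself"
  assumes odd_h: "odd h" and card_UNIV: "CARD('a) = 2 ^ h"
begin

lemma two_eq_0: "(2::'a) = 0"
  using of_nat_card_eq_0[where ?'a = 'a] by (simp add: card_UNIV)

lemma add_self: "x + x = (0::'a)"
  using two_eq_0 by (metis mult_2 mult_zero_left)

lemma add_self_left: "x + (x + y) = (y::'a)"
  by (simp add: add_self flip: add.assoc)

lemma uminus_eq: "- x = (x::'a)"
  using add_self by (metis minus_unique)

lemma add_eq_0_iff_eq: "x + y = 0 \<longleftrightarrow> x = (y::'a)"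
  by (metis add_eq_0_iff uminus_eq)

lemma power2_add: "(x + y)\<^sup>2 = x\<^sup>2 + (y::'a)\<^sup>2"
  by (simp add: power2_sum two_eq_0)

lemma power2_eq_iff_eq: "x\<^sup>2 = y\<^sup>2 \<longleftrightarrow> x = (y::'a)"
  by (metis power2_eq_iff uminus_eq)

lemma power_two_power_add: "(x + y) ^ 2 ^ i = x ^ 2 ^ i + (y::'a) ^ 2 ^ i"
  by (induction i) (simp_all add: power_mult mult.commute[of 2] power2_add)

section \<open>The absolute trace and its kernels on subgroups\<close>

definition tr :: "'a \<Rightarrow> 'a" where "tr x = (\<Sum>i<h. x ^ 2 ^ i)"

lemma abs_trace_eq_tr: "abs_trace = tr"
  by (simp add: fun_eq_iff abs_trace_def tr_def card_UNIV)

lemma tr_add: "tr (x + y) = tr x + tr y"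
  by (simp add: tr_def power_two_power_add sum.distrib)

lemma tr_0 [simp]: "tr 0 = 0"
  by (simp add: tr_def power_0_left)

lemma tr_1 [simp]: "tr 1 = 1"
proof -
  obtain m where "h = 2 * m + 1" using odd_h by (elim oddE)
  then show ?thesis unfolding tr_def by (simp add: two_eq_0)
qed

text \<open>Squaring shifts the exponents \<open>2 ^ i\<close> by one step, and
  \<open>x ^ 2 ^ h = x\<close> closes the cycle.\<close>

lemma tr_power2: "tr (x\<^sup>2) = tr x"
proof -
  have "tr (x\<^sup>2) = (\<Sum>i<h. x ^ 2 ^ Suc i)"
    by (simp add: tr_def flip: power_mult)
  then have "tr (x\<^sup>2) + x ^ 2 ^ 0 = (\<Sum>i<Suc h. x ^ 2 ^ i)"
    by (simp only: sum.lessThan_Suc_shift) simp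
  also have "\<dots> = tr x + x"
    using finite_field_power_card[of x] by (simp add: tr_def card_UNIV)
  finally show ?thesis by simp
qed

lemma tr_in_prime_field: "tr x = 0 \<or> tr x = 1"
proof -
  have "(\<Sum>i\<in>I. f i)\<^sup>2 = (\<Sum>i\<in>I. (f i)\<^sup>2)" for I :: "nat set" and f :: "nat \<Rightarrow> 'a"
    by (induction I rule: infinite_finite_induct) (simp_all add: power2_add)
  then have "(tr x)\<^sup>2 = tr (x\<^sup>2)"
    by (simp add: tr_def mult.commute flip: power_mult)
  then have "(tr x)\<^sup>2 = tr x" by (simp only: tr_power2)
  then have "tr x * (tr x - 1) = 0" by (simp add: power2_eq_square right_diff_distrib)
  then show ?thesis by simp
qed

lemma additive_subgroup_UNIV: "additive_subgroup (UNIV :: 'a set)"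
  by (simp add: additive_subgroup_def)

lemma additive_subgroup_cmult:
  "additive_subgroup A \<Longrightarrow> additive_subgroup ((\<lambda>x. k * x) ` (A :: 'a set))"
  by (auto simp: additive_subgroup_def uminus_eq simp flip: distrib_left)

text \<open>Translation by \<open>x0\<close> exchanges the elements of \<open>G\<close> on which the
  functional is 0 with those on which it is 1.\<close>

lemma card_tr_kernel:
  fixes k :: 'a
  assumes G: "additive_subgroup G" and x0: "x0 \<in> G" "tr (k * x0) = 1"
  shows "card G = 2 * card {x \<in> G. tr (k * x) = 0}"
proof -
  have "bij_betw (\<lambda>x. x + x0) {x \<in> G. tr (k * x) = 0} {x \<in> G. tr (k * x) = 1}"
    using G x0
    by (intro bij_betwI[where g = "\<lambda>x. x + x0"])
       (auto simp: additive_subgroup_def ring_distribs tr_add add_self add.assoc)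
  then have "card {x \<in> G. tr (k * x) = 1} = card {x \<in> G. tr (k * x) = 0}"
    by (simp add: bij_betw_same_card)
  moreover have "G = {x \<in> G. tr (k * x) = 0} \<union> {x \<in> G. tr (k * x) = 1}"
    using tr_in_prime_field by auto
  then have "card G = card ({x \<in> G. tr (k * x) = 0} \<union> {x \<in> G. tr (k * x) = 1})"
    by simp
  then have "card G = card {x \<in> G. tr (k * x) = 0} + card {x \<in> G. tr (k * x) = 1}"
    by (subst (asm) card_Un_disjoint) auto
  ultimately show ?thesis by simp
qed

lemma card_le_tr_kernel:
  fixes k :: 'a
  assumes "additive_subgroup G"
  shows "card G \<le> 2 * card {x \<in> G. tr (k * x) = 0}"
proof (cases "\<exists>x\<in>G. tr (k * x) = 1")
  case True
  then show ?thesis using card_tr_kernel[OF assms] by fastforce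
next
  case False
  then have "{x \<in> G. tr (k * x) = 0} = G" using tr_in_prime_field by blast
  then show ?thesis by simp
qed

section \<open>The Artin-Schreier map\<close>

lemma card_artin_schreier_vimage:
  "card {s::'a. s\<^sup>2 + s \<in> Y} = 2 * card (Y \<inter> range (\<lambda>s. s\<^sup>2 + s))"
proof -
  let ?f = "\<lambda>s::'a. s\<^sup>2 + s"
  let ?R = "Y \<inter> range ?f"
  have fiber: "card {s. ?f s = y} = 2" if y: "y \<in> ?R" for y
  proof -
    obtain r where r: "y = r\<^sup>2 + r" using y by auto
    have "?f s = y \<longleftrightarrow> s = r \<or> s = r + 1" for s
    proof -
      have "?f s + y = (s + r)\<^sup>2 + (s + r)"
        by (simp add: r power2_add add_ac)
      also have "\<dots> = (s + r) * (s + (r + 1))"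
        by (simp add: power2_eq_square algebra_simps)
      finally have "?f s = y \<longleftrightarrow> (s + r) * (s + (r + 1)) = 0"
        using add_eq_0_iff_eq[of "?f s" y] by simp
      then show ?thesis
        by (simp only: mult_eq_0_iff add_eq_0_iff_eq)
    qed
    then have "{s. ?f s = y} = {r, r + 1}" by auto
    then show ?thesis by simp
  qed
  have "{s. ?f s \<in> Y} = (\<Union>y\<in>?R. {s. ?f s = y})" by auto
  also have "card \<dots> = (\<Sum>y\<in>?R. card {s. ?f s = y})"
    by (intro card_UN_disjoint) auto
  finally show ?thesis using fiber by simp
qed

lemma tr_artin_schreier [simp]: "tr (s\<^sup>2 + s) = 0"
  by (simp add: tr_add tr_power2 add_self)

text \<open>Additive Hilbert 90: the range of \<open>s\<^sup>2 + s\<close> lies in the kernel of the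
  trace, and both have half the size of the field.\<close>

lemma tr_eq_0_iff: "tr y = 0 \<longleftrightarrow> (\<exists>s. y = s\<^sup>2 + s)"
proof -
  have "CARD('a) = 2 * card {x. tr x = 0}"
    using card_tr_kernel[OF additive_subgroup_UNIV, of 1 1] by simp
  moreover have "CARD('a) = 2 * card (range (\<lambda>s::'a. s\<^sup>2 + s))"
    using card_artin_schreier_vimage[of UNIV] by simp
  ultimately have "range (\<lambda>s::'a. s\<^sup>2 + s) = {x. tr x = 0}"
    by (intro card_subset_eq) auto
  then show ?thesis by (auto simp: set_eq_iff image_iff)
qed

section \<open>The norm form\<close>

definition nrm :: "'a \<Rightarrow> 'a \<Rightarrow> 'a" where "nrm a b = a\<^sup>2 + a * b + b\<^sup>2"

lemma nrm_0_right: "nrm a 0 = a\<^sup>2"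
  by (simp add: nrm_def)

lemma nrm_eq_0_iff: "nrm a b = 0 \<longleftrightarrow> a = 0 \<and> b = 0"
proof
  assume eq: "nrm a b = 0"
  have "b = 0"
  proof (rule ccontr)
    assume "b \<noteq> 0"
    \<comment> \<open>A zero with \<open>b\<close> nonzero would make 0 a value of
      \<open>s\<^sup>2 + s + 1\<close>, whose trace is 1 because \<open>h\<close> is odd.\<close>
    then have "(a / b)\<^sup>2 + a / b + 1 = nrm a b / b\<^sup>2"
      by (simp add: nrm_def field_simps power2_eq_square)
    then have "tr ((a / b)\<^sup>2 + a / b + 1) = 0"
      using eq by simp
    then show False
      by (simp only: tr_add[of _ 1] tr_artin_schreier) simp
  qed
  then show "a = 0 \<and> b = 0" using eq by (simp add: nrm_def)
qed (simp add: nrm_def)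

text \<open>
  With \<open>\<omega>\<^sup>2 = \<omega> + 1\<close>, \<open>nrm a b\<close> is the norm of \<open>a + b \<omega>\<close> and \<open>a * d + b * c\<close> is the trace of
  \<open>(a + b \<omega>)\<close> times the conjugate of \<open>(c + d \<omega>)\<close>, so multiplicativity of the norm gives the
  following identity.
\<close>

lemma nrm_mult:
  "nrm a b * nrm c d = nrm (a * c + a * d + b * d) (a * d + b * c)"
proof -
  have "nrm (a * c + a * d + b * d) (a * d + b * c) - nrm a b * nrm c d
      = 2 * (a\<^sup>2 * c * d + a\<^sup>2 * d\<^sup>2 + 2 * a * b * c * d + a * b * d\<^sup>2)"
    unfolding nrm_def by algebra
  then show ?thesis by (simp add: two_eq_0)
qed

lemma tr_nrm_mult_eq_1:
  assumes "a * d + b * c = 1"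
  shows "tr (nrm a b * nrm c d) = 1"
proof -
  have "nrm e 1 = (e\<^sup>2 + e) + 1" for e by (simp add: nrm_def)
  then show ?thesis
    by (simp only: nrm_mult assms tr_add[of _ 1] tr_artin_schreier) simp
qed

text \<open>The linear coefficient is the polar form of \<open>nrm\<close>, whose diagonal terms
  double to zero. In characteristic 2 it is also the determinant of \<open>(a, b)\<close> and
  \<open>(c, d)\<close>, so it vanishes exactly when the line passes through the origin.\<close>

lemma nrm_line:
  "nrm (a + t * c) (b + t * d) = nrm c d * t\<^sup>2 + (a * d + b * c) * t + nrm a b"
proof -
  have "nrm (a + t * c) (b + t * d) - (nrm c d * t\<^sup>2 + (a * d + b * c) * t + nrm a b)
      = 2 * (a * t * c + b * t * d)"
    by (simp add: nrm_def power2_eq_square algebra_simps)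
  then show ?thesis by (simp add: two_eq_0)
qed

section \<open>Counting the solutions of \<open>nrm a b \<in> A\<close> on affine lines and in the
  affine plane\<close>

lemma card_scaled_squares:
  fixes k c :: 'a
  assumes "k \<noteq> 0"
  shows "card {t. k * (t + c)\<^sup>2 \<in> A} = card A"
proof -
  let ?f = "\<lambda>t. k * (t + c)\<^sup>2"
  have inj: "inj ?f"
    using assms by (auto simp: inj_def power2_eq_iff_eq)
  then have "surj ?f" by (simp add: finite_UNIV_inj_surj)
  then have "?f ` (?f -` A) = A" by (simp add: surj_image_vimage_eq)
  then show ?thesis
    using card_image[OF inj_on_subset[OF inj], of "?f -` A"] by (simp add: vimage_def)
qed

lemma card_line_section:
  fixes a b c d :: 'a
  assumes A: "additive_subgroup A" and cd: "c \<noteq> 0 \<or> d \<noteq> 0"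
  defines "T \<equiv> {t. nrm (a + t * c) (b + t * d) \<in> A}"
  shows "card T = 0 \<or> card T = card A"
proof -
  let ?N = "nrm c d" and ?B = "a * d + b * c"
  have N: "?N \<noteq> 0" using cd by (simp add: nrm_eq_0_iff)
  show ?thesis
  proof (cases "?B = 0")
    case True
    then have B: "a * d = b * c" by (simp add: add_eq_0_iff_eq)
    obtain k where k: "a = k * c" "b = k * d"
    proof (cases "c = 0")
      case True
      with B cd show ?thesis by (intro that[of "b / d"]) auto
    next
      case False
      with B show ?thesis by (intro that[of "a / c"]) (auto simp: field_simps)
    qed
    have "nrm (a + t * c) (b + t * d) = ?N * (t + k)\<^sup>2" for t
      by (simp add: k nrm_def power2_eq_square algebra_simps)
    then show ?thesis
      using card_scaled_squares[OF N] by (simp add: T_def)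
  next
    case B: False
    let ?g = "\<lambda>t. nrm (a + t * c) (b + t * d)"
    \<comment> \<open>The substitution \<open>t = t0 + s * ?B / ?N\<close> turns
      \<open>?N * t\<^sup>2 + ?B * t\<close> into a constant plus
      \<open>(s\<^sup>2 + s) * ?B\<^sup>2 / ?N\<close>; \<open>?k\<close> removes the last
      factor.\<close>
    let ?k = "?N / ?B\<^sup>2"
    let ?A = "(\<lambda>x. ?k * x) ` A"
    have k: "?k \<noteq> 0" using N B by simp
    have g_nonzero: "?g t \<noteq> 0" for t
    proof
      assume "?g t = 0"
      then have "a = t * c" "b = t * d" by (simp_all add: nrm_eq_0_iff add_eq_0_iff_eq)
      then show False using B by (simp add: add_self algebra_simps)
    qed
    show ?thesis
    proof (cases "T = {}")
      case False
      then obtain t0 where t0: "?g t0 \<in> A" by (auto simp: T_def)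
      let ?s = "\<lambda>s. t0 + s * ?B / ?N"
      have scale: "N / B\<^sup>2 * (N * (s * B / N)\<^sup>2 + B * (s * B / N)) = s\<^sup>2 + s"
        if "N \<noteq> 0" "B \<noteq> 0" for N B s :: 'a
        using that by (simp add: field_simps power2_eq_square)
      have g_shift: "?k * ?g (?s s) = ?k * ?g t0 + (s\<^sup>2 + s)" for s
      proof -
        have "?k * (?g (?s s) + ?g t0) = ?k * (?N * (s * ?B / ?N)\<^sup>2 + ?B * (s * ?B / ?N))"
          unfolding nrm_line power2_add
          by (simp add: ring_distribs add_ac add_self add_self_left)
        also have "\<dots> = s\<^sup>2 + s"
          using N B by (rule scale)
        finally show ?thesis
          by (simp add: ring_distribs) (metis add.commute add_self_left)
      qed
      \<comment> \<open>As \<open>?g t0\<close> lies in the subgroup \<open>A\<close>, membership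
        can be tested on the difference from it, where the constant term is gone.\<close>
      have mem: "?g (?s s) \<in> A \<longleftrightarrow> s\<^sup>2 + s \<in> ?A" for s
      proof -
        have "?g (?s s) \<in> A \<longleftrightarrow> ?g (?s s) + ?g t0 \<in> A"
          using A t0 add_self[of "?g t0"]
          by (metis (no_types, lifting) additive_subgroup_def add.assoc add.right_neutral)
        also have "\<dots> \<longleftrightarrow> ?k * (?g (?s s) + ?g t0) \<in> ?A"
          using k by (auto simp: image_iff)
        also have "?k * (?g (?s s) + ?g t0) = s\<^sup>2 + s"
          using g_shift[of s]
          by (simp only: ring_distribs) (metis add.commute add_self_left)
        finally show ?thesis .
      qed
      have bij: "bij ?s"
        using N B by (intro bij_betwI[where g = "\<lambda>t. (t - t0) * ?N / ?B"]) auto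
      have "?s -` T = {s. s\<^sup>2 + s \<in> ?A}"
        by (simp only: T_def vimage_def mem mem_Collect_eq)
      then have "card T = card {s. s\<^sup>2 + s \<in> ?A}"
        using card_vimage_inj[OF bij_is_inj[OF bij], of T] bij_is_surj[OF bij]
        by (metis subset_UNIV)
      also have "\<dots> = 2 * card (?A \<inter> range (\<lambda>s. s\<^sup>2 + s))"
        by (rule card_artin_schreier_vimage)
      also have "?A \<inter> range (\<lambda>s. s\<^sup>2 + s) = {x \<in> ?A. tr (1 * x) = 0}"
        using tr_eq_0_iff by auto
      also have "2 * card \<dots> = card ?A"
      proof -
        \<comment> \<open>Trace 0 would make this value \<open>s\<^sup>2 + s\<close> for some
          \<open>s\<close>, and the shift by that \<open>s\<close> would produce a zero of
          \<open>?g\<close>. Hence \<open>?A\<close> has an element of trace 1, and the trace kernel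
          halves it.\<close>
        have "tr (?k * ?g t0) \<noteq> 0"
        proof
          assume "tr (?k * ?g t0) = 0"
          then obtain s where "?k * ?g t0 = s\<^sup>2 + s" by (auto simp: tr_eq_0_iff)
          then have "?k * ?g (?s s) = 0" by (simp only: g_shift add_self)
          then show False using k g_nonzero[of "?s s"] by simp
        qed
        then have tr1: "tr (1 * (?k * ?g t0)) = 1" using tr_in_prime_field by auto
        show ?thesis
          by (rule card_tr_kernel[OF additive_subgroup_cmult[OF A] imageI[OF t0] tr1, symmetric])
      qed
      also have "card ?A = card A"
        using k by (intro card_image) (auto simp: inj_on_def)
      finally show ?thesis ..
    qed simp
  qed
qed

text \<open>The plane is swept by the lines through the origin, on each of which \<open>nrm\<close>
  is a nonzero multiple of a square and so a bijection onto the field. The line \<open>b = 0\<close>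
  contributes \<open>card A\<close> pairs; each of the \<open>CARD('a)\<close> lines
  \<open>a = s * b\<close> contributes one fewer, since the origin is already counted.\<close>

lemma card_nrm_vimage:
  assumes A: "additive_subgroup A"
  shows "card {(a, b). nrm a b \<in> A} = (card A - 1) * CARD('a) + card A"
proof -
  let ?R = "\<lambda>s. {b. nrm s 1 * b\<^sup>2 \<in> A} - {0}"
  let ?D1 = "(\<lambda>a. (a, 0::'a)) ` {a::'a. a\<^sup>2 \<in> A}"
  let ?D2 = "(\<lambda>(s, b). (s * b, b)) ` (SIGMA s:UNIV. ?R s)"
  have zero: "0 \<in> A" using A by (simp add: additive_subgroup_def)
  have eq: "nrm (s * b) b = nrm s 1 * b\<^sup>2" for s b
    by (simp add: nrm_def power2_eq_square algebra_simps)
  have "(a, b) \<in> ?D2" if "nrm a b \<in> A" "b \<noteq> 0" for a b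
    using that eq[of "a / b" b] by (intro image_eqI[where x = "(a / b, b)"]) auto
  then have pairs: "(a, b) \<in> ?D1 \<union> ?D2" if "nrm a b \<in> A" for a b
    using that by (cases "b = 0") (auto simp: nrm_0_right)
  have "{(a, b). nrm a b \<in> A} = ?D1 \<union> ?D2"
    using pairs by (auto simp: eq simp flip: nrm_0_right)
  moreover have "?D1 \<inter> ?D2 = {}" by auto
  ultimately have "card {(a, b). nrm a b \<in> A} = card ?D1 + card ?D2"
    by (simp add: card_Un_disjoint)
  also have "card ?D1 = card A"
    using card_scaled_squares[of 1 0 A] by (subst card_image) (auto simp: inj_on_def)
  also have "card ?D2 = card (SIGMA s:UNIV. ?R s)"
    by (intro card_image) (auto simp: inj_on_def)
  also have "\<dots> = (\<Sum>s\<in>(UNIV::'a set). card (?R s))"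
    by simp
  also have "\<dots> = (\<Sum>s\<in>(UNIV::'a set). card A - 1)"
    using card_scaled_squares[of "nrm s 1" 0 A for s] zero
    by (intro sum.cong refl) (simp add: nrm_eq_0_iff card_Diff_singleton)
  finally show ?thesis by simp
qed

section \<open>Totally isotropic subgroups for the trace form\<close>

text \<open>Induction adjoining one generator at a time. The last conjunct carries the induction: it
  keeps the orthogonal complement of \<open>A\<close> in the trace kernel large enough to contain a
  new generator.\<close>

lemma exists_tr_isotropic_subgroup:
  assumes "2 * k + 1 \<le> h"
  shows "\<exists>A. additive_subgroup A \<and> card A = 2 ^ k \<and> (\<forall>x\<in>A. tr x = 0) \<and>
    (\<forall>x\<in>A. \<forall>y\<in>A. tr (x * y) = 0) \<and>
    CARD('a) \<le> 2 ^ (k + 1) * card {x. tr x = 0 \<and> (\<forall>a\<in>A. tr (a * x) = 0)}"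
  using assms
proof (induction k)
  case 0
  have "CARD('a) = 2 * card {x. tr x = 0}"
    using card_tr_kernel[OF additive_subgroup_UNIV, of 1 1] by simp
  then show ?case
    by (intro exI[of _ "{0}"]) (simp add: additive_subgroup_def)
next
  case (Suc k)
  then obtain A where A: "additive_subgroup A" "card A = 2 ^ k"
    and tr_A: "\<And>x. x \<in> A \<Longrightarrow> tr x = 0" "\<And>x y. x \<in> A \<Longrightarrow> y \<in> A \<Longrightarrow> tr (x * y) = 0"
    and "CARD('a) \<le> 2 ^ (k + 1) * card {x. tr x = 0 \<and> (\<forall>a\<in>A. tr (a * x) = 0)}"
    by auto
  define W where "W = {x. tr x = 0 \<and> (\<forall>a\<in>A. tr (a * x) = 0)}"
  have card_W: "CARD('a) \<le> 2 ^ (k + 1) * card W"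
    unfolding W_def by fact
  have W: "additive_subgroup W"
    by (auto simp: W_def additive_subgroup_def uminus_eq tr_add ring_distribs)
  \<comment> \<open>Here \<open>2 * k + 1 < h\<close>, so the complement \<open>W\<close> is
    strictly larger than \<open>A\<close> and supplies \<open>v\<close>.\<close>
  have "2 ^ (k + 1) * (2::nat) ^ k < 2 ^ h"
    using Suc.prems by (simp flip: power_add power_Suc)
  also have "\<dots> \<le> 2 ^ (k + 1) * card W"
    using card_W by (simp add: card_UNIV)
  finally have "card A < card W" using A by simp
  then obtain v where v: "v \<in> W" "v \<notin> A"
    by (metis card_mono finite not_le subsetI)
  define A' where "A' = A \<union> (\<lambda>a. v + a) ` A"
  have A'_cases: "\<exists>a\<in>A. x = a \<or> x = v + a" if "x \<in> A'" for x
    using that by (auto simp: A'_def)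
  have A_add: "x + y \<in> A" if "x \<in> A" "y \<in> A" for x y
    using A that by (simp add: additive_subgroup_def)
  have sub: "additive_subgroup A'"
    unfolding additive_subgroup_def
  proof (intro conjI ballI)
    show "0 \<in> A'" using A by (simp add: A'_def additive_subgroup_def)
    fix x assume x: "x \<in> A'"
    then show "- x \<in> A'" by (simp add: uminus_eq)
    fix y assume y: "y \<in> A'"
    have in_A': "a \<in> A'" "v + a \<in> A'" if "a \<in> A" for a
      using that by (auto simp: A'_def)
    obtain a b where ab: "a \<in> A" "b \<in> A" and "x = a \<or> x = v + a" "y = b \<or> y = v + b"
      using A'_cases[OF x] A'_cases[OF y] by blast
    then have "x + y = a + b \<or> x + y = v + (a + b)"
      by (auto simp: add_ac add_self add_self_left)
    then show "x + y \<in> A'" using in_A'[OF A_add[OF ab]] by auto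
  qed
  have disj: "A \<inter> (\<lambda>a. v + a) ` A = {}"
  proof -
    have False if "a \<in> A" "v + a \<in> A" for a
      using A_add[OF that(2,1)] v by (simp add: add.assoc add_self)
    then show ?thesis by auto
  qed
  have "card A' = card A + card ((\<lambda>a. v + a) ` A)"
    unfolding A'_def using disj by (intro card_Un_disjoint) auto
  then have card': "card A' = 2 ^ Suc k"
    using A by (simp add: card_image)
  \<comment> \<open>The generator \<open>v\<close> is orthogonal to itself because
    \<open>tr (v * v) = tr v\<close>.\<close>
  have v_tr: "tr v = 0" "tr (v * v) = 0" "\<And>a. a \<in> A \<Longrightarrow> tr (a * v) = 0" "\<And>a. a \<in> A \<Longrightarrow> tr (v * a) = 0"
    using v tr_power2[of v] by (auto simp: W_def power2_eq_square mult.commute)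
  have tr1: "tr x = 0" if "x \<in> A'" for x
    using A'_cases[OF that] v_tr tr_A by (auto simp: tr_add)
  have tr2: "tr (x * y) = 0" if "x \<in> A'" "y \<in> A'" for x y
    using A'_cases[OF that(1)] A'_cases[OF that(2)] v_tr tr_A by (auto simp: tr_add ring_distribs)
  have "v \<in> A'" using A by (auto simp: A'_def additive_subgroup_def image_iff)
  \<comment> \<open>Adjoining \<open>v\<close> imposes a single further linear condition on
    \<open>W\<close>, which at most halves it.\<close>
  have "{x \<in> W. tr (v * x) = 0} = {x. tr x = 0 \<and> (\<forall>a\<in>A'. tr (a * x) = 0)}"
    using \<open>v \<in> A'\<close> by (auto simp: W_def A'_def ring_distribs tr_add)
  then have "card W \<le> 2 * card {x. tr x = 0 \<and> (\<forall>a\<in>A'. tr (a * x) = 0)}"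
    using card_le_tr_kernel[OF W, of v] by simp
  from order_trans[OF card_W mult_le_mono2[OF this]]
  have "CARD('a) \<le> 2 ^ (Suc k + 1) * card {x. tr x = 0 \<and> (\<forall>a\<in>A'. tr (a * x) = 0)}"
    by simp
  then show ?case using sub card' tr1 tr2 by blast
qed

section \<open>From affine coordinates to the projective plane\<close>

definition affine_point :: "'a \<times> 'a \<Rightarrow> ('a ^ 3) set" where
  "affine_point = (\<lambda>(a, b). vec.span {vector [1, a, b]})"

lemma affine_vector_neq_0: "vector [1, a, b] \<noteq> (0 :: 'a ^ 3)"
  by (metis vector_3(1) zero_index zero_neq_one)

lemma vec3_eq_iff: "x = y \<longleftrightarrow> x $ 1 = y $ 1 \<and> x $ 2 = y $ 2 \<and> x $ 3 = (y :: 'a ^ 3) $ 3"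
  by (simp add: vec_eq_iff forall_3)

lemma affine_point_subset_iff:
  assumes "vec.subspace L"
  shows "affine_point (a, b) \<subseteq> L \<longleftrightarrow> vector [1, a, b] \<in> L"
  using assms vec.span_minimal[of "{vector [1, a, b]}" L]
  by (auto simp: affine_point_def intro: vec.span_base)

lemma inj_affine_point: "inj affine_point"
proof (rule injI, clarify)
  fix a b c d assume "affine_point (a, b) = affine_point (c, d)"
  then have "vector [1, a, b] \<in> vec.span {vector [1, c, d] :: 'a ^ 3}"
    by (metis affine_point_def case_prod_conv insertI1 vec.span_base)
  then obtain k where "vector [1, a, b] = k *s (vector [1, c, d] :: 'a ^ 3)"
    by (auto simp: vec.span_singleton)
  then show "a = c \<and> b = d" by (auto simp: vec3_eq_iff)
qed

lemma pg_points_eq_span: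
  assumes "P \<in> pg_points"
  obtains v :: "'a ^ 3" where "v \<noteq> 0" "P = vec.span {v}"
proof -
  obtain B where B: "vec.independent B" "vec.span B = P" "card B = 1"
    using assms vec.basis_subspace_exists[of P] by (auto simp: pg_points_def)
  then obtain v where "B = {v}" by (auto simp: card_1_singleton_iff)
  with B that show ?thesis by auto
qed

lemma Union_denniston_conic:
  "(\<Union>\<mu>\<in>A. denniston_conic 1 \<mu>) = affine_point ` {(a, b). nrm a b \<in> A}"
proof (intro equalityI subsetI)
  fix P :: "('a ^ 3) set" assume "P \<in> (\<Union>\<mu>\<in>A. denniston_conic 1 \<mu>)"
  then obtain \<mu> where \<mu>: "\<mu> \<in> A" "P \<in> denniston_conic 1 \<mu>" by auto
  then obtain v where v: "v \<noteq> 0" "P = vec.span {v}"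
    using pg_points_eq_span by (auto simp: denniston_conic_def)
  with \<mu> have eq: "nrm (v $ 2) (v $ 3) = \<mu> * (v $ 1)\<^sup>2"
    by (simp add: span_in_denniston_conic_iff nrm_def add_eq_0_iff_eq)
  \<comment> \<open>The conics miss the line at infinity: \<open>v $ 1 = 0\<close> would make the
    norm of the other two coordinates vanish, hence \<open>v = 0\<close>.\<close>
  have v1: "v $ 1 \<noteq> 0"
    using eq v by (auto simp: nrm_eq_0_iff vec3_eq_iff)
  let ?a = "v $ 2 / v $ 1" and ?b = "v $ 3 / v $ 1"
  have "nrm ?a ?b = nrm (v $ 2) (v $ 3) / (v $ 1)\<^sup>2"
    using v1 by (simp add: nrm_def power2_eq_square field_simps)
  then have "nrm ?a ?b = \<mu>" using eq v1 by simp
  moreover have "v = v $ 1 *s vector [1, ?a, ?b]"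
    using v1 by (simp add: vec3_eq_iff)
  then have "P = affine_point (?a, ?b)"
    using v v1 vec.span_image_scale[of "{vector [1, ?a, ?b]}" "\<lambda>_. v $ 1"]
    by (metis (no_types, lifting) affine_point_def case_prod_conv finite.emptyI finite.insertI
        image_empty image_insert)
  ultimately show "P \<in> affine_point ` {(a, b). nrm a b \<in> A}" using \<mu> by auto
next
  fix P assume "P \<in> affine_point ` {(a, b). nrm a b \<in> A}"
  then obtain a b where "P = vec.span {vector [1, a, b]}" "nrm a b \<in> A"
    by (auto simp: affine_point_def)
  then show "P \<in> (\<Union>\<mu>\<in>A. denniston_conic 1 \<mu>)"
    by (intro UN_I[of "nrm a b"])
       (simp_all add: span_in_denniston_conic_iff affine_vector_neq_0 nrm_def add_self)
qed

lemma pg_line_affine_part: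
  fixes L :: "('a ^ 3) set"
  assumes "L \<in> pg_lines" and ab: "vector [1, a, b] \<in> L"
  obtains c d where "c \<noteq> 0 \<or> d \<noteq> 0"
    "{(x, y). vector [1, x, y] \<in> L} = range (\<lambda>t. (a + t * c, b + t * d))"
proof -
  let ?z = "vector [1, a, b] :: 'a ^ 3"
  have L: "vec.subspace L" "vec.dim L = 2" using assms by (auto simp: pg_lines_def)
  have "\<not> L \<subseteq> vec.span {?z}"
  proof
    assume "L \<subseteq> vec.span {?z}"
    then have "vec.dim L \<le> vec.dim {?z}" by (rule vec.dim_mono)
    also have "\<dots> \<le> card {?z}" by (intro vec.dim_le_card') simp
    finally show False using L by simp
  qed
  then obtain u where u: "u \<in> L" "u \<notin> vec.span {?z}" by blast
  \<comment> \<open>Clearing the first coordinate gives the point at infinity of \<open>L\<close>;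
    its other two coordinates are the direction \<open>(c, d)\<close>.\<close>
  define w where "w = u - u $ 1 *s ?z"
  have w: "w \<in> L" "w $ 1 = 0"
    using u ab L by (auto simp: w_def vec.subspace_diff vec.subspace_scale)
  have w_notin: "w \<notin> vec.span {?z}"
  proof
    assume "w \<in> vec.span {?z}"
    then have "w + u $ 1 *s ?z \<in> vec.span {?z}"
      by (metis insertI1 vec.span_add vec.span_base vec.span_scale)
    then show False using u by (simp add: w_def)
  qed
  have "?z \<noteq> 0" by (rule affine_vector_neq_0)
  then have "vec.independent {w, ?z}"
    by (intro vec.independent_insertI[OF w_notin]) simp
  moreover have "w \<noteq> ?z" using w_notin vec.span_base[of ?z "{?z}"] by auto
  ultimately have span: "L \<subseteq> vec.span {w, ?z}"
    using L ab w by (intro vec.card_ge_dim_independent) auto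
  have "{(x, y). vector [1, x, y] \<in> L} = range (\<lambda>t. (a + t * w $ 2, b + t * w $ 3))"
  proof (intro equalityI subsetI; clarify)
    fix x y assume "vector [1, x, y] \<in> L"
    then obtain t r where "vector [1, x, y] - t *s w = r *s ?z"
      using span by (auto simp: vec.span_insert vec.span_singleton)
    then have "vector [1, x, y] = t *s w + r *s ?z" by (simp add: algebra_simps)
    then have "x = a + t * w $ 2" "y = b + t * w $ 3"
      using w by (auto simp: vec3_eq_iff)
    then show "(x, y) \<in> range (\<lambda>t. (a + t * w $ 2, b + t * w $ 3))" by auto
  next
    fix x y t
    have "vector [1, a + t * w $ 2, b + t * w $ 3] = ?z + t *s w"
      using w by (simp add: vec3_eq_iff)
    then show "vector [1, a + t * w $ 2, b + t * w $ 3] \<in> L"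
      using L w ab by (simp add: vec.subspace_add vec.subspace_scale)
  qed
  moreover have "w $ 2 \<noteq> 0 \<or> w $ 3 \<noteq> 0"
    using w w_notin vec.span_zero vec3_eq_iff[of w 0] by (metis zero_index)
  ultimately show ?thesis using that by blast
qed

lemma denniston_maximal_arc_affine:
  assumes A: "additive_subgroup A"
  shows "denniston_maximal_arc (card A) (affine_point ` {(a, b). nrm a b \<in> A})"
proof -
  let ?S = "affine_point ` {(a, b). nrm a b \<in> A}"
  have "card ?S = (card A - 1) * CARD('a) + card A"
    using card_nrm_vimage[OF A] inj_affine_point by (simp add: card_image inj_on_subset)
  moreover have "0 < card A"
    using A by (auto simp: additive_subgroup_def card_gt_0_iff)
  moreover have "?S \<subseteq> pg_points"
    by (auto simp: affine_point_def intro!: span_in_pg_points affine_vector_neq_0)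
  moreover have "card {P \<in> ?S. P \<subseteq> L} = 0 \<or> card {P \<in> ?S. P \<subseteq> L} = card A"
    if L: "L \<in> pg_lines" for L
  proof (cases "\<exists>a b. vector [1, a, b] \<in> L")
    case True
    then obtain a b where "vector [1, a, b] \<in> L" by blast
    from pg_line_affine_part[OF L this] obtain c d where cd: "c \<noteq> 0 \<or> d \<noteq> 0"
      and L_eq: "{(x, y). vector [1, x, y] \<in> L} = range (\<lambda>t. (a + t * c, b + t * d))" .
    let ?T = "{t. nrm (a + t * c) (b + t * d) \<in> A}"
    have "{P \<in> ?S. P \<subseteq> L} =
      affine_point ` ({(x, y). nrm x y \<in> A} \<inter> {(x, y). vector [1, x, y] \<in> L})"
      using L affine_point_subset_iff[of L] by (fastforce simp: pg_lines_def)
    also have "\<dots> = affine_point ` (\<lambda>t. (a + t * c, b + t * d)) ` ?T"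
      unfolding L_eq by auto
    finally have "card {P \<in> ?S. P \<subseteq> L} = card ((\<lambda>t. (a + t * c, b + t * d)) ` ?T)"
      using card_image[OF inj_on_subset[OF inj_affine_point subset_UNIV]] by simp
    also have "\<dots> = card ?T"
      using cd by (intro card_image) (auto simp: inj_on_def)
    finally have "card {P \<in> ?S. P \<subseteq> L} = card ?T" .
    then show ?thesis using card_line_section[OF A cd, of a b] by simp
  next
    \<comment> \<open>Only the line at infinity has no affine point, and the arc misses it.\<close>
    case False
    then have "{P \<in> ?S. P \<subseteq> L} = {}"
      using L by (auto simp: affine_point_subset_iff pg_lines_def)
    then show ?thesis by (metis card.empty)
  qed
  ultimately have "maximal_arc (card A) ?S"
    unfolding maximal_arc_def by blast
  then show ?thesis
    unfolding denniston_maximal_arc_def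
    using A Union_denniston_conic[of A] by (metis abs_trace_eq_tr tr_1)
qed

section \<open>The pseudo polarity in affine coordinates\<close>

lemma affine_point_subset_pseudo_polarity_iff:
  "affine_point (c, d) \<subseteq> pseudo_polarity (affine_point (a, b)) \<longleftrightarrow> a * d + b * c = 1"
proof -
  have eq: "pseudo_polarity (affine_point (a, b)) = {X. X $ 1 + b * X $ 2 + a * X $ 3 = 0}"
    by (simp add: affine_point_def pseudo_polarity_span)
  \<comment> \<open>Linearity reduces containment of a whole point in its candidate polar line to
    that of its normalised vector.\<close>
  have "vec.subspace {X :: 'a ^ 3. X $ 1 + b * X $ 2 + a * X $ 3 = 0}"
  proof (rule vec.subspaceI, goal_cases)
    case (2 x y)
    have "(x + y) $ 1 + b * (x + y) $ 2 + a * (x + y) $ 3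
        = (x $ 1 + b * x $ 2 + a * x $ 3) + (y $ 1 + b * y $ 2 + a * y $ 3)"
      by (simp add: algebra_simps)
    with 2 show ?case by simp
  next
    case (3 k x)
    have "(k *s x) $ 1 + b * (k *s x) $ 2 + a * (k *s x) $ 3 = k * (x $ 1 + b * x $ 2 + a * x $ 3)"
      by (simp add: algebra_simps)
    with 3 show ?case by simp
  qed simp
  then have "affine_point (c, d) \<subseteq> pseudo_polarity (affine_point (a, b)) \<longleftrightarrow>
      1 + (b * c + a * d) = 0"
    unfolding eq by (subst affine_point_subset_iff) (auto simp: add.assoc)
  then show ?thesis by (auto simp: add_eq_0_iff_eq add.commute)
qed

end

theorem theorem2p14:
  fixes h :: nat
  assumes "odd h" and "CARD('a::{field,finite}) = 2 ^ h"
  shows "\<exists>n (S :: ('a ^ 3) set set).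
           real n = sqrt (real CARD('a) / 2) \<and> denniston_maximal_arc n S \<and>
           (\<forall>P\<in>S. \<forall>Q\<in>S. \<not> Q \<subseteq> pseudo_polarity P)"
proof -
  interpret odd_binary_field h "TYPE('a)"
    using assms by unfold_locales
  obtain m where m: "h = 2 * m + 1" using \<open>odd h\<close> by (elim oddE)
  then obtain A :: "'a set" where A: "additive_subgroup A" "card A = 2 ^ m"
    and isotropic: "\<And>x y. x \<in> A \<Longrightarrow> y \<in> A \<Longrightarrow> tr (x * y) = 0"
    using exists_tr_isotropic_subgroup[of m] by auto
  let ?S = "affine_point ` {(a, b). nrm a b \<in> A}"
  \<comment> \<open>Since \<open>h = 2 * m + 1\<close>, the square of \<open>2 ^ m\<close> is
    \<open>2 ^ h / 2\<close>.\<close>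
  have "real (card A) = sqrt (real CARD('a) / 2)"
    by (rule real_sqrt_unique[symmetric]) (simp_all add: A assms(2) m flip: power_mult mult.commute)
  moreover have "\<not> Q \<subseteq> pseudo_polarity P" if PQ: "P \<in> ?S" "Q \<in> ?S" for P Q
  proof
    assume incident: "Q \<subseteq> pseudo_polarity P"
    obtain a b c d where "P = affine_point (a, b)" "Q = affine_point (c, d)"
      and A_mem: "nrm a b \<in> A" "nrm c d \<in> A"
      using PQ by auto
    with incident have "tr (nrm a b * nrm c d) = 1"
      by (simp add: affine_point_subset_pseudo_polarity_iff tr_nrm_mult_eq_1)
    then show False using isotropic[OF A_mem] by simp
  qed
  ultimately show ?thesis
    using denniston_maximal_arc_affine[OF A(1)] by blast
qed

end
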